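(* Let $(g,\lambda,1)$ be an orthosymmetric real type with $\lambda=2\lambda_0>0$. Put $$\mathcal T_{g,\lambda,1}=\{[\beta]_2\in\mathcal E_{g,\lambda,1}:\ \beta_j\beta_{j+\lambda_0}\equiv0\bmod 2,\ j=1,2,\dots,\lambda_0\}.$$ Let $\tau\in\mathcal H_{g,\lambda,1}$. Then $$\sum_{[\beta]_2\in\mathcal T_{g,\lambda,1}}\Theta\left[\begin{smallmatrix}0\\ \beta\end{smallmatrix}\right](\tau)>0.$$ In particular, at least one element of the indexed family $\mathcal E(\tau)=\{\Theta\left[\begin{smallmatrix}0\\ \beta\end{smallmatrix}\right](\tau)\}_{[\beta]_2\in\mathcal E_{g,\lambda,1}}$ is strictly positive.
   Context: An orthosymmetric real type is a triple $(g,\lambda,1)$ of integers with $g\ge1$, $0\le\lambda\le g$ and $\lambda$ even; write $\lambda=2\lambda_0$. Let $M=M_{g,\lambda,1}$ be the $g\times g$ matrix $\begin{bmatrix} M_{\lambda,\lambda,1}&0\\0&0\end{bmatrix}$ with $M_{\lambda,\lambda,1}=\begin{bmatrix}0&\mathrm{Id}_{\lambda_0}\\ \mathrm{Id}_{\lambda_0}&0\end{bmatrix}$. $\mathcal H_g$ is the Siegel upper half space of complex symmetric $g\times g$ matrices with positive definite imaginary part, and $\mathcal H_{g,\lambda,1}=\{\tau\in\mathcal H_g: 2\,\mathrm{Re}(\tau)=M\}$. For $\beta\in\mathbb Z^g$ the theta constant is $\Theta\left[\begin{smallmatrix}0\\ \beta\end{smallmatrix}\right](\tau)=\sum_{m\in\mathbb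 Z^g}\exp(\pi i\, m^{\top}\tau m+\pi i\,\beta^{\top}m)$; it depends only on the class $[\beta]_2\in\mathbb Z_2^g$ of $\beta$ modulo 2, and it is real for $\tau\in\mathcal H_{g,\lambda,1}$. Finally $$\mathcal E_{g,\lambda,1}=\{[\beta]_2\in\mathbb Z_2^g:\ \beta^{\top}M\beta\equiv0\bmod 4,\ \beta_{\lambda+1}\equiv\dots\equiv\beta_g\equiv0\bmod 2\}.$$ *)

theory Defs
  imports
    "HOL-Analysis.Infinite_Sum"
    "HOL-Number_Theory.Cong"
    "HOL-Library.Complex_Order"
    "Jordan_Normal_Form.Matrix"
begin

text \<open>
  Matrices and vectors of size \<open>g\<close> are those of \<^theory>\<open>Jordan_Normal_Form.Matrix\<close>, so their
  indices run over \<open>0, ..., g - 1\<close>: the entry written \<open>\<beta>\<^sub>j\<close> in the usual 1-based notation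
  is \<open>\<beta> $ (j - 1)\<close>.
\<close>

definition orthosymmetric_real_type :: "nat \<Rightarrow> nat \<Rightarrow> bool" where
  "orthosymmetric_real_type g lam \<longleftrightarrow> 1 \<le> g \<and> lam \<le> g \<and> even lam"

definition M_block :: "nat \<Rightarrow> int mat" where
  "M_block lam = (let l = lam div 2 in four_block_mat (0\<^sub>m l l) (1\<^sub>m l) (1\<^sub>m l) (0\<^sub>m l l))"

definition M_mat :: "nat \<Rightarrow> nat \<Rightarrow> int mat" where
  "M_mat g lam = four_block_mat (M_block lam) (0\<^sub>m lam (g - lam))
                                (0\<^sub>m (g - lam) lam) (0\<^sub>m (g - lam) (g - lam))"

definition positive_definite :: "nat \<Rightarrow> real mat \<Rightarrow> bool" where
  "positive_definite g A \<longleftrightarrow> A \<in> carrier_mat g g \<and> A\<^sup>T = A \<and>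
     (\<forall>v\<in>carrier_vec g. v \<noteq> 0\<^sub>v g \<longrightarrow> 0 < v \<bullet> (A *\<^sub>v v))"

definition siegel_upper_half_space :: "nat \<Rightarrow> complex mat set" where
  "siegel_upper_half_space g =
     {\<tau> \<in> carrier_mat g g. \<tau>\<^sup>T = \<tau> \<and> positive_definite g (map_mat Im \<tau>)}"

definition siegel_real_locus :: "nat \<Rightarrow> nat \<Rightarrow> complex mat set" where
  "siegel_real_locus g lam =
     {\<tau> \<in> siegel_upper_half_space g. 2 \<cdot>\<^sub>m map_mat Re \<tau> = map_mat of_int (M_mat g lam)}"

definition theta_const :: "nat \<Rightarrow> int vec \<Rightarrow> complex mat \<Rightarrow> complex" where
  "theta_const g \<beta> \<tau> =
     (\<Sum>\<^sub>\<infinity>m\<in>carrier_vec g.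
        exp (pi * \<i> * (map_vec of_int m \<bullet> (\<tau> *\<^sub>v map_vec of_int m)) + pi * \<i> * of_int (\<beta> \<bullet> m)))"

definition mod2_rel :: "nat \<Rightarrow> (int vec \<times> int vec) set" where
  "mod2_rel g = {(\<beta>, \<gamma>). \<beta> \<in> carrier_vec g \<and> \<gamma> \<in> carrier_vec g \<and> (\<forall>i<g. [\<beta> $ i = \<gamma> $ i] (mod 2))}"

text \<open>The group \<open>\<int>\<^sub>2\<^sup>g\<close> is the quotient \<open>carrier_vec g // mod2_rel g\<close> of \<open>\<int>\<^sup>g\<close>.\<close>

definition mod2_class :: "nat \<Rightarrow> int vec \<Rightarrow> int vec set" where
  "mod2_class g \<beta> = mod2_rel g `` {\<beta>}"

definition E_set :: "nat \<Rightarrow> nat \<Rightarrow> int vec set set" where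
  "E_set g lam = {mod2_class g \<beta> | \<beta>. \<beta> \<in> carrier_vec g \<and>
     [\<beta> \<bullet> (M_mat g lam *\<^sub>v \<beta>) = 0] (mod 4) \<and> (\<forall>i\<in>{lam..<g}. [\<beta> $ i = 0] (mod 2))}"

definition T_set :: "nat \<Rightarrow> nat \<Rightarrow> int vec set set" where
  "T_set g lam = {mod2_class g \<beta> | \<beta>. \<beta> \<in> carrier_vec g \<and> mod2_class g \<beta> \<in> E_set g lam \<and>
     (\<forall>j<lam div 2. [\<beta> $ j * \<beta> $ (j + lam div 2) = 0] (mod 2))}"

text \<open>
  The theta constant of a class in \<open>\<int>\<^sub>2\<^sup>g\<close> is that of any representative; the choice is
  immaterial by \<open>theta_class_mod2_class\<close> below.
\<close>

definition theta_class :: "nat \<Rightarrow> int vec set \<Rightarrow> complex mat \<Rightarrow> complex" where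
  "theta_class g C \<tau> = theta_const g (SOME \<beta>. \<beta> \<in> C) \<tau>"

text \<open>
  Theta constants are compared with \<open>0\<close> in the order of \<^theory>\<open>HOL-Library.Complex_Order\<close>:
  \<open>0 < z\<close> means that the complex number \<open>z\<close> is real and strictly positive.
\<close>

lemma equiv_mod2_rel: "equiv (carrier_vec g) (mod2_rel g)"
  by (rule equivI)
     (auto simp: mod2_rel_def refl_on_def sym_def trans_def intro: cong_sym cong_trans)

lemma theta_const_mod2_cong:
  assumes "(\<beta>, \<gamma>) \<in> mod2_rel g"
  shows "theta_const g \<beta> \<tau> = theta_const g \<gamma> \<tau>"
  unfolding theta_const_def
proof (rule infsum_cong)
  fix m :: "int vec" assume m: "m \<in> carrier_vec g"
  have "[\<beta> \<bullet> m = \<gamma> \<bullet> m] (mod 2)"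
    using assms m unfolding scalar_prod_def mod2_rel_def
    by (auto intro!: cong_sum cong_mult)
  then obtain k where k: "\<beta> \<bullet> m = \<gamma> \<bullet> m + 2 * k"
    by (metis cong_iff_lin cong_sym)
  have "exp (x + pi * \<i> * of_int (\<gamma> \<bullet> m + 2 * k)) = exp (x + pi * \<i> * of_int (\<gamma> \<bullet> m))" for x
  proof -
    have "exp (x + pi * \<i> * of_int (\<gamma> \<bullet> m + 2 * k))
            = exp (x + pi * \<i> * of_int (\<gamma> \<bullet> m)) * exp ((2 * of_int k * pi) * \<i>)"
      unfolding exp_add[symmetric] by (simp add: algebra_simps)
    also have "exp ((2 * of_int k * pi) * \<i>) = 1"
      using cis_multiple_2pi[of "of_int k"] by (simp add: cis_conv_exp mult_ac)
    finally show ?thesis by simp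
  qed
  then show "exp (pi * \<i> * (map_vec of_int m \<bullet> (\<tau> *\<^sub>v map_vec of_int m)) + pi * \<i> * of_int (\<beta> \<bullet> m)) =
    exp (pi * \<i> * (map_vec of_int m \<bullet> (\<tau> *\<^sub>v map_vec of_int m)) + pi * \<i> * of_int (\<gamma> \<bullet> m))"
    unfolding k .
qed

lemma theta_class_mod2_class:
  assumes "\<beta> \<in> carrier_vec g"
  shows "theta_class g (mod2_class g \<beta>) \<tau> = theta_const g \<beta> \<tau>"
proof -
  have "\<beta> \<in> mod2_class g \<beta>"
    using assms by (simp add: mod2_class_def mod2_rel_def)
  then have "(SOME \<gamma>. \<gamma> \<in> mod2_class g \<beta>) \<in> mod2_class g \<beta>"
    by (rule someI)
  then show ?thesis
    unfolding theta_class_def by (intro theta_const_mod2_cong[symmetric]) (simp add: mod2_class_def)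
qed

end

theory Submission
  imports Defs "HOL-Analysis.Function_Topology"
begin

text \<open>
  Since \<open>2 Re \<tau> = M\<close>, the \<open>m\<close>-th term of the theta series of \<open>\<beta>\<close> is the positive number
  \<open>exp (- \<pi> m\<^sup>T Im(\<tau>) m)\<close> times the sign with exponent \<open>\<Sum>\<^sub>j m\<^sub>j m\<^bsub>j+l\<^esub> + \<beta> \<bullet> m\<close>, where \<open>l = \<lambda>/2\<close>.
  The set \<open>T\<close> is a product over \<open>j \<le> l\<close> of copies of \<open>{(0,0), (1,0), (0,1)}\<close>, so
  summing these signs over \<open>T\<close> gives a product over \<open>j\<close>. Its \<open>j\<close>-th factor
  \<open>(-1)\<^bsup>ab\<^esup> (1 + (-1)\<^bsup>a\<^esup> + (-1)\<^bsup>b\<^esup>)\<close>, with \<open>a = m\<^sub>j\<close> and \<open>b = m\<^bsub>j+l\<^esub>\<close>, is \<open>3\<close> when \<open>a\<close> and \<open>b\<close> are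
  both even and \<open>1\<close> otherwise. Hence every term of the summed series is positive, and the series
  converges because \<open>Im(\<tau>)\<close> is bounded below by a positive multiple of the identity.
\<close>

section \<open>Coercivity of positive definite forms and convergence of Gaussian series\<close>

lemma scalar_prod_mult_mat_vec:
  fixes A :: "'a::comm_semiring_0 mat"
  assumes "A \<in> carrier_mat n n" "v \<in> carrier_vec n"
  shows "v \<bullet> (A *\<^sub>v v) = (\<Sum>i<n. \<Sum>j<n. A $$ (i, j) * (v $ i * v $ j))"
  using assms
  by (auto simp: scalar_prod_def atLeast0LessThan sum_distrib_left ac_simps intro!: sum.cong)

text \<open>By compactness the form attains a minimum on the unit sphere, which is positive by
  definiteness. Homogeneity of degree 2 carries this bound to every vector, with the minimum as
  \<open>c\<close>.\<close>

lemma positive_definite_lower_bound: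
  assumes "positive_definite g A"
  obtains c where "c > 0"
    and "\<And>v. v \<in> carrier_vec g \<Longrightarrow> c * (\<Sum>i<g. (v $ i)\<^sup>2) \<le> v \<bullet> (A *\<^sub>v v)"
proof (cases "g = 0")
  case True
  then show ?thesis
    by (intro that[of 1]) (auto simp: scalar_prod_def)
next
  case False
  have A: "A \<in> carrier_mat g g"
    and pos: "\<And>v. v \<in> carrier_vec g \<Longrightarrow> v \<noteq> 0\<^sub>v g \<Longrightarrow> 0 < v \<bullet> (A *\<^sub>v v)"
    using assms by (auto simp: positive_definite_def)
  define q :: "(nat \<Rightarrow> real) \<Rightarrow> real"
    where "q x = (\<Sum>i<g. \<Sum>j<g. A $$ (i, j) * (x i * x j))" for x
  have q_vec: "q x = vec g x \<bullet> (A *\<^sub>v vec g x)" for x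
    using scalar_prod_mult_mat_vec[OF A, of "vec g x"] by (simp add: q_def)
  \<comment> \<open>Vectors are modelled as functions on all of \<open>nat\<close> that vanish from
    \<open>g\<close> on, so that \<open>B\<close> is a product of compact sets and hence compact by
    Tychonoff. The set \<open>K\<close> below is the unit sphere inside this box.\<close>
  define B :: "(nat \<Rightarrow> real) set" where "B = (\<Pi>\<^sub>E i\<in>UNIV. if i < g then {-1..1} else {0})"
  define K where "K = B \<inter> {x. (\<Sum>i<g. (x i)\<^sup>2) = 1}"
  have "compact B"
    unfolding B_def
    by (subst compactin_euclidean_iff[symmetric], subst euclidean_product_topology[symmetric],
        subst compactin_PiE) auto
  moreover have "closed {x :: nat \<Rightarrow> real. (\<Sum>i<g. (x i)\<^sup>2) = 1}"
    by (intro closed_Collect_eq continuous_intros continuous_on_product_coordinates)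
  ultimately have "compact K"
    unfolding K_def by (rule compact_Int_closed)
  \<comment> \<open>The first unit vector shows that the sphere is nonempty; here \<open>g\<close>
    must be nonzero.\<close>
  moreover have "(\<lambda>i. if i = 0 then 1 else 0) \<in> K"
    using False by (auto simp: K_def B_def if_distrib[of "\<lambda>x. x ^ 2"] cong: if_cong)
  moreover have "continuous_on K q"
    unfolding q_def by (intro continuous_intros continuous_on_subset[OF continuous_on_product_coordinates]) auto
  ultimately obtain x0 where x0: "x0 \<in> K" "\<And>x. x \<in> K \<Longrightarrow> q x0 \<le> q x"
    using continuous_attains_inf[of K q] by auto
  have "vec g x0 \<noteq> 0\<^sub>v g"
  proof
    assume "vec g x0 = 0\<^sub>v g"
    then have "x0 i = 0" if "i < g" for i
      using that by (metis index_vec index_zero_vec(1))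
    then show False
      using x0(1) by (simp add: K_def)
  qed
  then have "0 < q x0"
    unfolding q_vec by (intro pos) auto
  moreover have "q x0 * (\<Sum>i<g. (v $ i)\<^sup>2) \<le> v \<bullet> (A *\<^sub>v v)" if v: "v \<in> carrier_vec g" for v
  proof (cases "v = 0\<^sub>v g")
    case True
    then show ?thesis using A by simp
  next
    case nonzero: False
    define s where "s = (\<Sum>i<g. (v $ i)\<^sup>2)"
    obtain k where k: "k < g" "v $ k \<noteq> 0"
      using nonzero v by (metis carrier_vecD eq_vecI index_zero_vec)
    have le_s: "(v $ i)\<^sup>2 \<le> s" if "i < g" for i
      unfolding s_def using that by (intro member_le_sum) auto
    have "s > 0"
      using less_le_trans[OF _ le_s[OF k(1)], of 0] k(2) by simp
    \<comment> \<open>Rescaling \<open>v\<close> to length 1 divides the form by \<open>s\<close>,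
      the squared length of \<open>v\<close>.\<close>
    define x where "x i = (if i < g then v $ i / sqrt s else 0)" for i
    have sq: "(x i)\<^sup>2 = (v $ i)\<^sup>2 / s" if "i < g" for i
      using that \<open>s > 0\<close> by (simp add: x_def power_divide)
    have "(\<Sum>i<g. (x i)\<^sup>2) = 1"
      using \<open>s > 0\<close> by (simp add: sq sum_divide_distrib[symmetric]) (simp add: s_def)
    moreover have "\<bar>x i\<bar> \<le> 1" if "i < g" for i
      using sq[OF that] le_s[OF that] \<open>s > 0\<close> by (intro abs_square_le_1[THEN iffD1]) simp
    then have "x \<in> B"
      unfolding B_def by (auto simp: abs_le_iff) (auto simp: x_def minus_le_iff)
    ultimately have "q x0 \<le> q x"
      by (intro x0(2)) (simp add: K_def)
    also have "q x = (v \<bullet> (A *\<^sub>v v)) / s"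
    proof -
      have "A $$ (i, j) * (x i * x j) = A $$ (i, j) * (v $ i * v $ j) / s" if "i < g" "j < g" for i j
        using that \<open>s > 0\<close> by (simp add: x_def)
      then show ?thesis
        unfolding scalar_prod_mult_mat_vec[OF A v] q_def sum_divide_distrib
        by (intro sum.cong) auto
    qed
    finally show ?thesis
      using \<open>s > 0\<close> by (simp add: s_def pos_le_divide_eq)
  qed
  ultimately show ?thesis
    using that by blast
qed

text \<open>Two geometric series, over the nonnegative and the nonpositive integers, cover the sum;
  their overlap at 0 is harmless for summability.\<close>

lemma summable_on_exp_abs_int:
  fixes c :: real
  assumes "c > 0"
  shows "(\<lambda>n::int. exp (- c * \<bar>n\<bar>)) summable_on UNIV"
proof -
  have "summable (\<lambda>n::nat. exp (- c) ^ n)"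
    using assms by (intro summable_geometric) simp
  then have nat: "(\<lambda>n::nat. exp (- c * real n)) summable_on UNIV"
    by (intro summable_nonneg_imp_summable_on)
       (auto simp: exp_of_nat_mult[symmetric] mult.commute)
  have "(\<lambda>n::int. exp (- c * \<bar>n\<bar>)) summable_on range int"
    using nat by (subst summable_on_reindex) (auto simp: o_def)
  moreover have "(\<lambda>n::int. exp (- c * \<bar>n\<bar>)) summable_on range (\<lambda>n. - int n)"
    using nat by (subst summable_on_reindex) (auto simp: o_def inj_on_def)
  ultimately have "(\<lambda>n::int. exp (- c * \<bar>n\<bar>)) summable_on (range int \<union> range (\<lambda>n. - int n))"
    by (rule summable_on_union)
  moreover have "n \<in> range int \<union> range (\<lambda>n. - int n)" for n
    by (cases n rule: int_cases2) auto
  then have "range int \<union> range (\<lambda>n. - int n) = UNIV"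
    by blast
  ultimately show ?thesis by simp
qed

text \<open>Integers satisfy \<open>\<bar>n\<bar> \<le> n^2\<close>, so each term is at most a
  product of one-dimensional terms. A finite set of vectors lies in a finite box, over which the sum
  of these products factors and is at most \<open>S ^ g\<close>.\<close>

lemma summable_on_exp_vec:
  fixes c :: real
  assumes "c > 0"
  shows "(\<lambda>m :: int vec. exp (- c * (\<Sum>i<g. (of_int (m $ i))\<^sup>2))) summable_on carrier_vec g"
proof (rule nonneg_bdd_above_summable_on)
  define S where "S = (\<Sum>\<^sub>\<infinity>n::int. exp (- c * \<bar>n\<bar>))"
  have "sum (\<lambda>m :: int vec. exp (- c * (\<Sum>i<g. (of_int (m $ i))\<^sup>2))) F \<le> S ^ g"
    if F: "F \<subseteq> carrier_vec g" "finite F" for F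
  proof -
    define B where "B = (\<Union>i<g. (\<lambda>m. m $ i) ` F)"
    have "finite B" using F by (auto simp: B_def)
    \<comment> \<open>Restriction to \<open>{..<g}\<close> turns vectors into members of the
      extensional product, as required for expanding a product of sums.\<close>
    define h where "h = (\<lambda>m :: int vec. \<lambda>i\<in>{..<g}. m $ i)"
    have inj: "inj_on h F"
    proof (rule inj_onI)
      fix x y assume *: "x \<in> F" "y \<in> F" "h x = h y"
      have "x $ i = y $ i" if "i < g" for i
        using fun_cong[OF *(3), of i] that by (simp add: h_def)
      moreover have "dim_vec x = g" "dim_vec y = g"
        using *(1,2) F(1) carrier_vecD by blast+
      ultimately show "x = y" by (intro eq_vecI) simp_all
    qed
    have sub: "h ` F \<subseteq> (\<Pi>\<^sub>E i\<in>{..<g}. B)"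
      by (auto simp: h_def B_def split: if_splits)
    have "sum (\<lambda>m :: int vec. exp (- c * (\<Sum>i<g. (of_int (m $ i))\<^sup>2))) F
        \<le> (\<Sum>m\<in>F. \<Prod>i<g. exp (- c * \<bar>of_int (h m i)\<bar>))"
    proof (rule sum_mono)
      fix m assume "m \<in> F"
      have "\<bar>real_of_int n\<bar> \<le> (of_int n)\<^sup>2" for n
        using self_le_power[of "\<bar>real_of_int n\<bar>" 2] by (cases "n = 0") auto
      then have "(\<Sum>i<g. \<bar>real_of_int (m $ i)\<bar>) \<le> (\<Sum>i<g. (of_int (m $ i))\<^sup>2)"
        by (intro sum_mono)
      then show "exp (- c * (\<Sum>i<g. (of_int (m $ i))\<^sup>2)) \<le> (\<Prod>i<g. exp (- c * \<bar>of_int (h m i)\<bar>))"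
        using assms by (simp add: exp_sum[symmetric] sum_distrib_left[symmetric] sum_negf h_def)
    qed
    also have "\<dots> = (\<Sum>x\<in>h ` F. \<Prod>i<g. exp (- c * \<bar>of_int (x i)\<bar>))"
      using inj by (simp add: sum.reindex)
    also have "\<dots> \<le> (\<Sum>x\<in>(\<Pi>\<^sub>E i\<in>{..<g}. B). \<Prod>i<g. exp (- c * \<bar>of_int (x i)\<bar>))"
      using sub \<open>finite B\<close> by (intro sum_mono2 finite_PiE prod_nonneg) auto
    also have "\<dots> = (\<Prod>i<g. \<Sum>n\<in>B. exp (- c * \<bar>of_int n\<bar>))"
      using \<open>finite B\<close> by (subst prod_sum_PiE) auto
    also have "\<dots> \<le> (\<Prod>i<g. S)"
      using finite_sum_le_infsum[OF summable_on_exp_abs_int[OF assms] \<open>finite B\<close>]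
      by (intro prod_mono) (auto simp: S_def intro: sum_nonneg)
    finally show ?thesis by simp
  qed
  then show "bdd_above (sum (\<lambda>m :: int vec. exp (- c * (\<Sum>i<g. (of_int (m $ i))\<^sup>2)))
      ` {F. F \<subseteq> carrier_vec g \<and> finite F})"
    by (auto intro!: bdd_aboveI2)
qed auto

lemma summable_on_exp_positive_definite:
  assumes "positive_definite g A" "t > 0"
  shows "(\<lambda>m :: int vec. exp (- t * (map_vec of_int m \<bullet> (A *\<^sub>v map_vec of_int m)))) summable_on carrier_vec g"
proof -
  obtain c where c: "c > 0"
    "\<And>v. v \<in> carrier_vec g \<Longrightarrow> c * (\<Sum>i<g. (v $ i)\<^sup>2) \<le> v \<bullet> (A *\<^sub>v v)"
    using positive_definite_lower_bound[OF assms(1)] by blast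
  show ?thesis
  proof (rule summable_on_comparison_test)
    show "(\<lambda>m :: int vec. exp (- (t * c) * (\<Sum>i<g. (of_int (m $ i))\<^sup>2))) summable_on carrier_vec g"
      using assms(2) c(1) by (intro summable_on_exp_vec) simp
  next
    fix m :: "int vec" assume m: "m \<in> carrier_vec g"
    then have "c * (\<Sum>i<g. (of_int (m $ i))\<^sup>2) \<le> map_vec of_int m \<bullet> (A *\<^sub>v map_vec of_int m)"
      using c(2)[of "map_vec of_int m"] by auto
    then show "exp (- t * (map_vec of_int m \<bullet> (A *\<^sub>v map_vec of_int m)))
      \<le> exp (- (t * c) * (\<Sum>i<g. (of_int (m $ i))\<^sup>2))"
      using assms(2) by (simp add: mult.assoc)
  qed auto
qed

section \<open>The quadratic form of M and the theta series on the real locus\<close>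

lemma M_mat_carrier:
  assumes "even lam" "lam \<le> g"
  shows "M_mat g lam \<in> carrier_mat g g"
proof -
  have "lam div 2 + lam div 2 = lam"
    using assms(1) by presburger
  then show ?thesis
    using assms(2) by (intro carrier_matI) (simp_all add: M_mat_def M_block_def Let_def)
qed

text \<open>The two indicators never hold together. Writing the entry as their sum splits the
  quadratic form into two mutually transposed halves.\<close>

lemma M_mat_index:
  assumes "even lam" "lam \<le> g" "i < g" "j < g"
  shows "M_mat g lam $$ (i, j) =
    (if i < lam div 2 \<and> j = i + lam div 2 then 1 else 0) + (if j < lam div 2 \<and> i = j + lam div 2 then 1 else 0)"
proof -
  obtain l where "lam = l + l"
    using assms(1) by (metis evenE mult_2)
  then show ?thesis
    using assms(2-4) by (auto simp: M_mat_def M_block_def Let_def)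
qed

lemma M_mat_quadratic_form:
  assumes "even lam" "lam \<le> g" "v \<in> carrier_vec g"
  shows "v \<bullet> (M_mat g lam *\<^sub>v v) = 2 * (\<Sum>j<lam div 2. v $ j * v $ (j + lam div 2))"
proof -
  define l where "l = lam div 2"
  have l: "2 * l \<le> g" using assms by (simp add: l_def)
  \<comment> \<open>\<open>P\<close> carries the upper right identity block; the lower left one is
    its transpose and contributes the same sum, whence the factor 2.\<close>
  define P where "P i j = (if i < l \<and> j = i + l then v $ i * v $ j else 0)" for i j
  have P: "(\<Sum>i<g. \<Sum>j<g. P i j) = (\<Sum>j<l. v $ j * v $ (j + l))"
  proof -
    have "(\<Sum>j<g. P i j) = (if i \<in> {..<l} then v $ i * v $ (i + l) else 0)" for i
      using l by (auto simp: P_def)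
    then have "(\<Sum>i<g. \<Sum>j<g. P i j) = (\<Sum>i\<in>{..<g} \<inter> {..<l}. v $ i * v $ (i + l))"
      by (simp only: sum.inter_restrict finite_lessThan)
    moreover have "{..<g} \<inter> {..<l} = {..<l}" using l by auto
    ultimately show ?thesis by simp
  qed
  have "v \<bullet> (M_mat g lam *\<^sub>v v) = (\<Sum>i<g. \<Sum>j<g. M_mat g lam $$ (i, j) * (v $ i * v $ j))"
    using assms by (intro scalar_prod_mult_mat_vec M_mat_carrier)
  also have "\<dots> = (\<Sum>i<g. \<Sum>j<g. P i j + P j i)"
    using assms by (intro sum.cong) (auto simp: M_mat_index P_def l_def)
  also have "\<dots> = (\<Sum>i<g. \<Sum>j<g. P i j) + (\<Sum>i<g. \<Sum>j<g. P j i)"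
    by (simp add: sum.distrib)
  also have "(\<Sum>i<g. \<Sum>j<g. P j i) = (\<Sum>i<g. \<Sum>j<g. P i j)"
    by (rule sum.swap)
  finally show ?thesis
    by (simp add: P l_def)
qed

lemma exp_pi_i_of_int: "exp (pi * \<i> * of_int k) = of_real ((-1) powi k)"
proof -
  have "exp (pi * \<i> * of_int k) = exp (\<i> * pi) powi k"
    unfolding exp_power_int by (simp only: mult_ac)
  then show ?thesis
    by (simp only: exp_pi_i') simp
qed

text \<open>The real part of the matrix is M/2 and the form of M is even on integer vectors, so the
  real part of the exponent's form is an integer. This is what turns the phase of each theta term
  into a sign.\<close>

lemma siegel_real_locus_quadratic_form:
  assumes "even lam" "lam \<le> g" "\<tau> \<in> siegel_real_locus g lam" "m \<in> carrier_vec g"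
  shows "map_vec of_int m \<bullet> (\<tau> *\<^sub>v map_vec of_int m) =
    Complex (of_int (\<Sum>j<lam div 2. m $ j * m $ (j + lam div 2)))
            (map_vec of_int m \<bullet> (map_mat Im \<tau> *\<^sub>v map_vec of_int m))"
    (is "?z = Complex (of_int ?s) ?q")
proof (rule complex_eqI)
  have \<tau>: "\<tau> \<in> carrier_mat g g" and Re_\<tau>: "2 \<cdot>\<^sub>m map_mat Re \<tau> = map_mat of_int (M_mat g lam)"
    using assms(3) by (auto simp: siegel_real_locus_def siegel_upper_half_space_def)
  have M: "M_mat g lam \<in> carrier_mat g g" using assms by (intro M_mat_carrier)
  have Re_index: "2 * Re (\<tau> $$ (i, j)) = of_int (M_mat g lam $$ (i, j))" if "i < g" "j < g" for i j
    using arg_cong[OF Re_\<tau>, of "\<lambda>A. A $$ (i, j)"] \<tau> M that by auto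
  have z: "?z = (\<Sum>i<g. \<Sum>j<g. \<tau> $$ (i, j) * of_int (m $ i * m $ j))"
    using assms(4) \<tau> by (subst scalar_prod_mult_mat_vec) auto
  have "2 * Re ?z = (\<Sum>i<g. \<Sum>j<g. (2 * Re (\<tau> $$ (i, j))) * of_int (m $ i * m $ j))"
    unfolding z by (simp add: sum_distrib_left algebra_simps)
  also have "\<dots> = of_int (m \<bullet> (M_mat g lam *\<^sub>v m))"
    unfolding scalar_prod_mult_mat_vec[OF M assms(4)] of_int_sum
    by (intro sum.cong) (auto simp: Re_index)
  also have "\<dots> = 2 * of_int ?s"
    using assms by (simp add: M_mat_quadratic_form)
  finally show "Re ?z = Re (Complex (of_int ?s) ?q)" by simp
  have "?q = (\<Sum>i<g. \<Sum>j<g. Im (\<tau> $$ (i, j)) * of_int (m $ i * m $ j))"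
    using assms(4) \<tau> by (subst scalar_prod_mult_mat_vec) auto
  then show "Im ?z = Im (Complex (of_int ?s) ?q)"
    unfolding z by simp
qed

text \<open>Reality of the theta constant and convergence of the signed real series are obtained
  together, for the same \<open>x\<close>, so that series for different \<open>\<beta>\<close> can
  later be added term by term.\<close>

lemma theta_const_has_sum:
  assumes "even lam" "lam \<le> g" "\<tau> \<in> siegel_real_locus g lam"
  shows "\<exists>x. theta_const g \<beta> \<tau> = of_real x \<and>
    ((\<lambda>m. (-1) powi ((\<Sum>j<lam div 2. m $ j * m $ (j + lam div 2)) + \<beta> \<bullet> m) *
          exp (- pi * (map_vec of_int m \<bullet> (map_mat Im \<tau> *\<^sub>v map_vec of_int m)))) has_sum x)
         (carrier_vec g)"
proof -
  define f :: "int vec \<Rightarrow> real" where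
    "f m = (-1) powi ((\<Sum>j<lam div 2. m $ j * m $ (j + lam div 2)) + \<beta> \<bullet> m) *
          exp (- pi * (map_vec of_int m \<bullet> (map_mat Im \<tau> *\<^sub>v map_vec of_int m)))" for m
  have "positive_definite g (map_mat Im \<tau>)"
    using assms(3) by (auto simp: siegel_real_locus_def siegel_upper_half_space_def)
  from summable_on_exp_positive_definite[OF this pi_gt_zero]
  \<comment> \<open>The sign has absolute value 1, which leaves the Gaussian series of
    \<open>Im \<tau>\<close> with \<open>t = pi\<close>.\<close>
  have "f abs_summable_on carrier_vec g"
    by (simp add: f_def abs_mult power_int_abs)
  then have "(f has_sum infsum f (carrier_vec g)) (carrier_vec g)"
    by (rule has_sum_infsum[OF abs_summable_summable])
  moreover have "theta_const g \<beta> \<tau> = of_real (infsum f (carrier_vec g))"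
  proof -
    have "exp (pi * \<i> * (map_vec of_int m \<bullet> (\<tau> *\<^sub>v map_vec of_int m)) + pi * \<i> * of_int (\<beta> \<bullet> m))
        = of_real (f m)" if m: "m \<in> carrier_vec g" for m
    proof -
      define q where "q = map_vec of_int m \<bullet> (map_mat Im \<tau> *\<^sub>v map_vec of_int m)"
      define s where "s = (\<Sum>j<lam div 2. m $ j * m $ (j + lam div 2))"
      have "pi * \<i> * Complex (of_int s) q + pi * \<i> * of_int (\<beta> \<bullet> m)
          = pi * \<i> * of_int (s + \<beta> \<bullet> m) + of_real (- pi * q)"
        by (simp add: complex_eq_iff algebra_simps)
      then have "exp (pi * \<i> * Complex (of_int s) q + pi * \<i> * of_int (\<beta> \<bullet> m))
          = of_real ((-1) powi (s + \<beta> \<bullet> m)) * of_real (exp (- pi * q))"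
        by (simp only: exp_add exp_pi_i_of_int exp_of_real)
      then show ?thesis
        unfolding siegel_real_locus_quadratic_form[OF assms m]
        by (simp add: f_def q_def s_def)
    qed
    then have "theta_const g \<beta> \<tau> = (\<Sum>\<^sub>\<infinity>m\<in>carrier_vec g. of_real (f m))"
      unfolding theta_const_def by (rule infsum_cong)
    then show ?thesis
      using infsumI[OF has_sum_of_real[OF calculation, where 'a=complex]] by simp
  qed
  ultimately show ?thesis
    unfolding f_def by blast
qed

section \<open>Parametrization of T by isotropic pairs\<close>

text \<open>These represent the zeros of the hyperbolic form \<open>a * b\<close> on the plane over
  the field with two elements.\<close>

definition isotropic_pairs :: "(int \<times> int) set" where
  "isotropic_pairs = {(0, 0), (1, 0), (0, 1)}"

text \<open>M couples exactly the positions \<open>j\<close> and \<open>j + l\<close> with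
  \<open>j < l\<close>, so each pair fills one hyperbolic plane.\<close>

definition pair_vec :: "nat \<Rightarrow> nat \<Rightarrow> (nat \<Rightarrow> int \<times> int) \<Rightarrow> int vec" where
  "pair_vec g l \<phi> =
    vec g (\<lambda>i. if i < l then fst (\<phi> i) else if i < 2 * l then snd (\<phi> (i - l)) else 0)"

lemma pair_vec_carrier [simp]: "pair_vec g l \<phi> \<in> carrier_vec g"
  by (simp add: pair_vec_def)

lemma pair_vec_index:
  assumes "2 * l \<le> g"
  shows "j < l \<Longrightarrow> pair_vec g l \<phi> $ j = fst (\<phi> j)"
    and "j < l \<Longrightarrow> pair_vec g l \<phi> $ (j + l) = snd (\<phi> j)"
    and "2 * l \<le> j \<Longrightarrow> j < g \<Longrightarrow> pair_vec g l \<phi> $ j = 0"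
  using assms by (auto simp: pair_vec_def)

lemma sum_lessThan_double:
  fixes f :: "nat \<Rightarrow> 'a::comm_monoid_add"
  shows "(\<Sum>i<2 * l. f i) = (\<Sum>j<l. f j + f (j + l))"
proof -
  have "(\<Sum>i<2 * l. f i) = (\<Sum>i<l. f i) + (\<Sum>i=l..<l + l. f i)"
    using sum.atLeastLessThan_concat[of 0 l "l + l" f] by (simp add: atLeast0LessThan mult_2)
  also have "(\<Sum>i=l..<l + l. f i) = (\<Sum>j<l. f (j + l))"
    using sum.shift_bounds_nat_ivl[of f 0 l l] by (simp add: atLeast0LessThan)
  finally show ?thesis by (simp add: sum.distrib)
qed

lemma pair_vec_scalar_prod:
  assumes "2 * l \<le> g" "m \<in> carrier_vec g"
  shows "pair_vec g l \<phi> \<bullet> m = (\<Sum>j<l. fst (\<phi> j) * m $ j + snd (\<phi> j) * m $ (j + l))"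
proof -
  have "pair_vec g l \<phi> \<bullet> m = (\<Sum>i<g. pair_vec g l \<phi> $ i * m $ i)"
    using assms by (simp add: scalar_prod_def atLeast0LessThan)
  also have "\<dots> = (\<Sum>i<2 * l. pair_vec g l \<phi> $ i * m $ i)"
    using assms by (intro sum.mono_neutral_right) (auto simp: pair_vec_index(3))
  finally show ?thesis
    unfolding sum_lessThan_double using assms by (simp add: pair_vec_index)
qed

lemma mod2_class_eq_iff:
  assumes "\<beta> \<in> carrier_vec g" "\<gamma> \<in> carrier_vec g"
  shows "mod2_class g \<beta> = mod2_class g \<gamma> \<longleftrightarrow> (\<forall>i<g. [\<beta> $ i = \<gamma> $ i] (mod 2))"
  unfolding mod2_class_def
  using eq_equiv_class_iff[OF equiv_mod2_rel assms] assms by (simp add: mod2_rel_def)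

text \<open>Every class has exactly one representative with entries 0 and 1. Membership in T forces
  its tail to be zero and excludes the pair (1, 1) in each plane.\<close>

lemma bij_betw_pair_vec_T_set:
  assumes "even lam" "lam \<le> g"
  shows "bij_betw (\<lambda>\<phi>. mod2_class g (pair_vec g (lam div 2) \<phi>))
           (\<Pi>\<^sub>E j\<in>{..<lam div 2}. isotropic_pairs) (T_set g lam)"
proof -
  define l where "l = lam div 2"
  have lam: "lam = 2 * l" using assms(1) by (simp add: l_def)
  have l: "2 * l \<le> g" using assms(2) lam by simp
  have isotropic_pairs_cong: "p = p'"
    if "p \<in> isotropic_pairs" "p' \<in> isotropic_pairs" "[fst p = fst p'] (mod 2)" "[snd p = snd p'] (mod 2)" for p p'
    using that by (auto simp: isotropic_pairs_def cong_def)
  have "inj_on (\<lambda>\<phi>. mod2_class g (pair_vec g l \<phi>)) (\<Pi>\<^sub>E j\<in>{..<l}. isotropic_pairs)"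
  proof (rule inj_onI)
    fix \<phi> \<psi> assume \<phi>: "\<phi> \<in> (\<Pi>\<^sub>E j\<in>{..<l}. isotropic_pairs)" and \<psi>: "\<psi> \<in> (\<Pi>\<^sub>E j\<in>{..<l}. isotropic_pairs)"
      and "mod2_class g (pair_vec g l \<phi>) = mod2_class g (pair_vec g l \<psi>)"
    then have cong: "[pair_vec g l \<phi> $ i = pair_vec g l \<psi> $ i] (mod 2)" if "i < g" for i
      using that by (simp add: mod2_class_eq_iff)
    show "\<phi> = \<psi>"
    proof (rule PiE_ext[OF \<phi> \<psi>])
      fix j assume j: "j \<in> {..<l}"
      show "\<phi> j = \<psi> j"
      proof (rule isotropic_pairs_cong)
        show "[fst (\<phi> j) = fst (\<psi> j)] (mod 2)" "[snd (\<phi> j) = snd (\<psi> j)] (mod 2)"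
          using cong[of j] cong[of "j + l"] j l by (simp_all add: pair_vec_index)
      qed (use \<phi> \<psi> j in auto)
    qed
  qed
  moreover have "mod2_class g (pair_vec g l \<phi>) \<in> T_set g lam"
    if \<phi>: "\<phi> \<in> (\<Pi>\<^sub>E j\<in>{..<l}. isotropic_pairs)" for \<phi>
  proof -
    have prod: "pair_vec g l \<phi> $ j * pair_vec g l \<phi> $ (j + l) = 0" if "j < l" for j
    proof -
      have "\<phi> j \<in> isotropic_pairs" using \<phi> that by auto
      then show ?thesis
        using that l by (auto simp: pair_vec_index isotropic_pairs_def)
    qed
    \<comment> \<open>Each product of coupled entries is 0 as an integer, so the form vanishes
      exactly and not only modulo 4.\<close>
    have "pair_vec g l \<phi> \<bullet> (M_mat g lam *\<^sub>v pair_vec g l \<phi>) = 0"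
      using assms by (simp add: M_mat_quadratic_form prod flip: l_def)
    moreover have "\<forall>i\<in>{lam..<g}. [pair_vec g l \<phi> $ i = 0] (mod 2)"
      using l lam by (auto simp: pair_vec_index)
    ultimately have "mod2_class g (pair_vec g l \<phi>) \<in> E_set g lam"
      unfolding E_set_def by (auto intro!: exI[of _ "pair_vec g l \<phi>"])
    then show ?thesis
      unfolding T_set_def l_def[symmetric] by (auto intro!: exI[of _ "pair_vec g l \<phi>"] simp: prod)
  qed
  moreover have "C \<in> (\<lambda>\<phi>. mod2_class g (pair_vec g l \<phi>)) ` (\<Pi>\<^sub>E j\<in>{..<l}. isotropic_pairs)"
    if C: "C \<in> T_set g lam" for C
  proof -
    obtain \<beta> where \<beta>: "C = mod2_class g \<beta>" "\<beta> \<in> carrier_vec g" "mod2_class g \<beta> \<in> E_set g lam"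
      and prod: "\<And>j. j < l \<Longrightarrow> even (\<beta> $ j * \<beta> $ (j + l))"
      using C by (auto simp: T_set_def cong_0_iff l_def)
    \<comment> \<open>Membership in E provides some representative with even tail, possibly
      different from \<open>\<beta>\<close>; equality of classes carries this parity over to
      \<open>\<beta>\<close>.\<close>
    obtain \<gamma> where \<gamma>: "\<gamma> \<in> carrier_vec g" "mod2_class g \<beta> = mod2_class g \<gamma>"
      "\<And>i. i \<in> {lam..<g} \<Longrightarrow> [\<gamma> $ i = 0] (mod 2)"
      using \<beta>(3) by (auto simp: E_set_def)
    have tail: "[0 = \<beta> $ i] (mod 2)" if "2 * l \<le> i" "i < g" for i
    proof -
      have "[\<beta> $ i = \<gamma> $ i] (mod 2)"
        using \<gamma>(1,2) \<beta>(2) that by (simp add: mod2_class_eq_iff)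
      also have "[\<gamma> $ i = 0] (mod 2)" using \<gamma>(3) that lam by simp
      finally show ?thesis by (rule cong_sym)
    qed
    define \<phi> where "\<phi> = (\<lambda>j\<in>{..<l}. (\<beta> $ j mod 2, \<beta> $ (j + l) mod 2))"
    have "(\<beta> $ j mod 2, \<beta> $ (j + l) mod 2) \<in> isotropic_pairs" if "j < l" for j
      using prod[OF that] by (auto simp: isotropic_pairs_def mod2_eq_if)
    then have "\<phi> \<in> (\<Pi>\<^sub>E j\<in>{..<l}. isotropic_pairs)"
      by (simp add: \<phi>_def)
    moreover have "[pair_vec g l \<phi> $ i = \<beta> $ i] (mod 2)" if i: "i < g" for i
    proof -
      consider "i < l" | j where "i = j + l" "j < l" | "2 * l \<le> i"
        by (metis add.commute le_add_diff_inverse mult_2 nat_add_left_cancel_less not_less)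
      then show ?thesis
        using i l tail by cases (auto simp: pair_vec_index \<phi>_def)
    qed
    then have "C = mod2_class g (pair_vec g l \<phi>)"
      unfolding \<beta>(1) using \<beta>(2) by (subst mod2_class_eq_iff) (auto intro: cong_sym)
    ultimately show ?thesis by blast
  qed
  ultimately show ?thesis
    unfolding bij_betw_def l_def[symmetric] by blast
qed

section \<open>Positivity of the sign sums and of the summed theta series\<close>

text \<open>Only the parities of \<open>a\<close> and \<open>b\<close> matter. Over all four pairs
  the sum would be 4 if both are even and 0 otherwise; the excluded pair (1, 1) would contribute 1
  in the first case and -1 in the second.\<close>

lemma isotropic_pairs_sign_sum_pos:
  "0 < (\<Sum>(c, d)\<in>isotropic_pairs. (-1 :: real) powi (a * b + (c * a + d * b)))"
  unfolding isotropic_pairs_def by (cases "even a"; cases "even b") (auto simp: power_int_minus_left)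

lemma power_int_sum:
  fixes x :: "'a::field"
  assumes "x \<noteq> 0"
  shows "x powi (\<Sum>i\<in>A. f i) = (\<Prod>i\<in>A. x powi f i)"
  using assms by (induction A rule: infinite_finite_induct) (auto simp: power_int_add)

lemma sign_sum_pos:
  assumes "2 * l \<le> g" "m \<in> carrier_vec g"
  shows "0 < (\<Sum>\<phi>\<in>(\<Pi>\<^sub>E j\<in>{..<l}. isotropic_pairs).
    (-1 :: real) powi ((\<Sum>j<l. m $ j * m $ (j + l)) + pair_vec g l \<phi> \<bullet> m))"
proof -
  have "(\<Sum>\<phi>\<in>(\<Pi>\<^sub>E j\<in>{..<l}. isotropic_pairs).
    (-1 :: real) powi ((\<Sum>j<l. m $ j * m $ (j + l)) + pair_vec g l \<phi> \<bullet> m))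
    = (\<Sum>\<phi>\<in>(\<Pi>\<^sub>E j\<in>{..<l}. isotropic_pairs). \<Prod>j<l. case \<phi> j of (c, d) \<Rightarrow>
        (-1) powi (m $ j * m $ (j + l) + (c * m $ j + d * m $ (j + l))))"
    using assms
    by (simp add: pair_vec_scalar_prod sum.distrib[symmetric] power_int_sum case_prod_beta)
  \<comment> \<open>Distributivity: a choice function picks one pair per plane, independently of the
    other planes.\<close>
  also have "\<dots> = (\<Prod>j<l. \<Sum>(c, d)\<in>isotropic_pairs.
        (-1) powi (m $ j * m $ (j + l) + (c * m $ j + d * m $ (j + l))))"
    by (subst prod_sum_PiE) (auto simp: isotropic_pairs_def)
  also have "\<dots> > 0"
    by (intro prod_pos ballI isotropic_pairs_sign_sum_pos)
  finally show ?thesis .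
qed

text \<open>This moves the finite sum over T inside the theta series. For infinite \<open>I\<close>
  both finite sums are 0 by convention.\<close>

lemma has_sum_sum:
  fixes f :: "'a \<Rightarrow> 'b \<Rightarrow> 'c::topological_comm_monoid_add"
  assumes "\<And>i. i \<in> I \<Longrightarrow> (f i has_sum s i) A"
  shows "((\<lambda>x. \<Sum>i\<in>I. f i x) has_sum (\<Sum>i\<in>I. s i)) A"
  using assms by (induction I rule: infinite_finite_induct) (auto intro!: has_sum_add)

theorem theorem1p2:
  fixes g lam :: nat and \<tau> :: "complex mat"
  assumes "orthosymmetric_real_type g lam"
    and "lam > 0"
    and "\<tau> \<in> siegel_real_locus g lam"
  shows "0 < (\<Sum>C\<in>T_set g lam. theta_class g C \<tau>) \<and>
    (\<exists>C\<in>E_set g lam. 0 < theta_class g C \<tau>)"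
proof -
  have lam: "even lam" "lam \<le> g"
    using assms(1) by (auto simp: orthosymmetric_real_type_def)
  define l where "l = lam div 2"
  have l: "2 * l \<le> g" using lam by (simp add: l_def)
  define \<Phi> where "\<Phi> = (\<Pi>\<^sub>E j\<in>{..<l}. isotropic_pairs)"
  define e where "e m = exp (- pi * (map_vec of_int m \<bullet> (map_mat Im \<tau> *\<^sub>v map_vec of_int m)))"
    for m :: "int vec"
  define w :: "(nat \<Rightarrow> int \<times> int) \<Rightarrow> int vec \<Rightarrow> real" where
    "w \<phi> m = (-1) powi ((\<Sum>j<l. m $ j * m $ (j + l)) + pair_vec g l \<phi> \<bullet> m) * e m" for \<phi> m
  have "\<exists>x. theta_const g (pair_vec g l \<phi>) \<tau> = of_real x \<and> (w \<phi> has_sum x) (carrier_vec g)" for \<phi>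
    unfolding w_def e_def l_def using lam assms(3) by (rule theta_const_has_sum)
  then obtain t where t: "\<And>\<phi>. theta_const g (pair_vec g l \<phi>) \<tau> = of_real (t \<phi>)"
    "\<And>\<phi>. (w \<phi> has_sum t \<phi>) (carrier_vec g)"
    by metis
  have w_pos: "0 < (\<Sum>\<phi>\<in>\<Phi>. w \<phi> m)" if "m \<in> carrier_vec g" for m
    using sign_sum_pos[OF l that] by (simp add: w_def \<Phi>_def e_def flip: sum_distrib_right)
  have "((\<lambda>m. \<Sum>\<phi>\<in>\<Phi>. w \<phi> m) has_sum (\<Sum>\<phi>\<in>\<Phi>. t \<phi>)) (carrier_vec g)"
    by (intro has_sum_sum t)
  \<comment> \<open>Comparison with the zero series needs one index with strict inequality; the zero
    vector serves.\<close>
  from has_sum_strict_mono[OF has_sum_0 this, of "\<lambda>_. 0" "0\<^sub>v g"]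
  have sum_pos: "0 < (\<Sum>\<phi>\<in>\<Phi>. t \<phi>)"
    using w_pos by (auto intro: less_imp_le)
  have bij: "bij_betw (\<lambda>\<phi>. mod2_class g (pair_vec g l \<phi>)) \<Phi> (T_set g lam)"
    unfolding \<Phi>_def l_def using lam by (rule bij_betw_pair_vec_T_set)
  have theta: "theta_class g (mod2_class g (pair_vec g l \<phi>)) \<tau> = of_real (t \<phi>)" for \<phi>
    by (simp add: theta_class_mod2_class t(1))
  have "(\<Sum>C\<in>T_set g lam. theta_class g C \<tau>) = of_real (\<Sum>\<phi>\<in>\<Phi>. t \<phi>)"
    by (simp add: sum.reindex_bij_betw[OF bij, symmetric] theta)
  then have "0 < (\<Sum>C\<in>T_set g lam. theta_class g C \<tau>)"
    using sum_pos by (simp add: less_complex_def)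
  \<comment> \<open>A positive sum has a positive summand, and its class lies in T, hence in
    E.\<close>
  moreover obtain \<phi> where \<phi>: "\<phi> \<in> \<Phi>" "0 < t \<phi>"
    using sum_pos sum_nonpos[of \<Phi> t] by (meson not_less)
  have "mod2_class g (pair_vec g l \<phi>) \<in> T_set g lam"
    using bij_betw_apply[OF bij \<phi>(1)] .
  then have "mod2_class g (pair_vec g l \<phi>) \<in> E_set g lam"
    by (auto simp: T_set_def)
  then have "\<exists>C\<in>E_set g lam. 0 < theta_class g C \<tau>"
    using \<phi>(2) theta by (intro bexI) (auto simp: less_complex_def)
  ultimately show ?thesis ..
qed

end
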